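(* Let $\Omega\subset\mathbb{R}^3$ be a bounded domain, let $\Phi:[1,\infty)\to\mathbb{R}$ be convex and (strictly) increasing, and let $A\in GL(3,\mathbb{R})$ have three distinct singular values. Then there is $\delta>0$ with the following property: for every $\epsilon>0$ there is a quasiconformal mapping $f_\epsilon:\Omega\to\mathbb{R}^3$ such that 1. $\|f_\epsilon(z)-Az\|_{L^\infty(\Omega)}<\epsilon$, and 2. $\displaystyle\int_\Omega \Phi[\mathcal{H}(x,f_\epsilon)]\,dx<\int_\Omega\Phi[\mathcal{H}(A)]\,dx-\delta .$
   Context: For a homeomorphism $f:\Omega\to f(\Omega)\subset\mathbb{R}^3$ and $x\in\Omega$, the linear distortion of $f$ at $x$ is $$\mathcal{H}(x,f)=\limsup_{r\to0}\frac{\max_{|h|=r}|f(x+h)-f(x)|}{\min_{|h|=r}|f(x+h)-f(x)|}.$$ The map $f$ is quasiconformal if it is a homeomorphism onto its image and $\mathcal{H}(x,f)$ is bounded on $\Omega$ (orientation is not restricted). For $A\in GL(3,\mathbb{R})$, $\mathcal{H}(A)=\max_{|\zeta|=1}|A\zeta|\big/\min_{|\zeta|=1}|A\zeta|$, the ratio of the largest to the smallest singular value of $A$; this is the constant value of $\mathcal{H}(x,f)$ for the linear map $f(x)=Ax$. *)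

theory Defs
  imports "HOL-Analysis.Analysis" "HOL-Probability.Essential_Supremum"
begin

text \<open>
  A map on \<open>\<Omega>\<close> is a total function whose values outside \<open>\<Omega>\<close> are irrelevant.  In particular, for an
  interior point \<open>x\<close> of \<open>\<Omega>\<close> the upper limit below only sees spheres about \<open>x\<close> contained in \<open>\<Omega>\<close>;
  on these a homeomorphism attains its maximal and minimal displacement, and the latter is
  positive, so the quotient is a genuine one.  The upper limit itself may be infinite.
\<close>

definition linear_distortion :: "'a::euclidean_space \<Rightarrow> ('a \<Rightarrow> 'a) \<Rightarrow> ereal" where
  "linear_distortion x f =
     Limsup (at_right 0) (\<lambda>r::real. ereal
       ((SUP h\<in>sphere 0 r. norm (f (x + h) - f x)) / (INF h\<in>sphere 0 r. norm (f (x + h) - f x))))"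

definition quasiconformal_on :: "'a::euclidean_space set \<Rightarrow> ('a \<Rightarrow> 'a) \<Rightarrow> bool" where
  "quasiconformal_on \<Omega> f \<longleftrightarrow>
     (\<exists>g. homeomorphism \<Omega> (f ` \<Omega>) f g) \<and>
     (\<exists>K::real. \<forall>x\<in>\<Omega>. linear_distortion x f \<le> ereal K)"

definition matrix_distortion :: "real^'n^'n \<Rightarrow> real" where
  "matrix_distortion A =
     (SUP \<zeta>\<in>sphere 0 1. norm (A *v \<zeta>)) / (INF \<zeta>\<in>sphere 0 1. norm (A *v \<zeta>))"

text \<open>Singular values: the nonnegative square roots of the eigenvalues of \<open>A\<^sup>T A\<close>.\<close>

definition singular_values :: "real^'n^'n \<Rightarrow> real set" where
  "singular_values A =
     {s. 0 \<le> s \<and> (\<exists>v. v \<noteq> 0 \<and> (transpose A ** A) *v v = s\<^sup>2 *\<^sub>R v)}"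

definition Linf_norm :: "'a::euclidean_space set \<Rightarrow> ('a \<Rightarrow> 'b::real_normed_vector) \<Rightarrow> ereal" where
  "Linf_norm \<Omega> g = esssup (lebesgue_on \<Omega>) (\<lambda>z. ereal (norm (g z)))"

lemma linear_distortion_matrix:
  fixes A :: "real^'n^'n"
  shows "linear_distortion x (\<lambda>z. A *v z) = ereal (matrix_distortion A)"
proof -
  have sph: "sphere (0::real^'n) r = (\<lambda>\<zeta>. r *\<^sub>R \<zeta>) ` sphere 0 1" if "r > 0" for r :: real
  proof (intro equalityI subsetI)
    fix h :: "real^'n" assume "h \<in> sphere 0 r"
    then have "norm h = r" by simp
    then show "h \<in> (\<lambda>\<zeta>. r *\<^sub>R \<zeta>) ` sphere 0 1"
      using \<open>r > 0\<close> by (intro image_eqI[of _ _ "h /\<^sub>R r"]) auto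
  next
    fix h :: "real^'n" assume "h \<in> (\<lambda>\<zeta>. r *\<^sub>R \<zeta>) ` sphere 0 1"
    then obtain \<zeta> :: "real^'n" where "h = r *\<^sub>R \<zeta>" "norm \<zeta> = 1" by (metis imageE mem_sphere_0)
    then show "h \<in> sphere 0 r" using \<open>r > 0\<close> by simp
  qed
  define N where "N = (\<lambda>\<zeta>. norm (A *v \<zeta>)) ` sphere 0 1"
  have img: "(\<lambda>h. norm (A *v (x + h) - A *v x)) ` sphere 0 r = (\<lambda>t. r * t) ` N" if "r > 0" for r
    unfolding sph[OF that] N_def image_image
    using that by (simp add: matrix_vector_right_distrib matrix_vector_mult_scaleR)
  have comp: "compact N"
    unfolding N_def by (intro compact_continuous_image continuous_intros compact_sphere)
  obtain b :: "real^'n" where "b \<in> Basis" by (meson nonempty_Basis ex_in_conv)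
  then have "b \<in> sphere 0 1" by simp
  then have ne: "N \<noteq> {}" unfolding N_def by blast
  have q: "Sup ((\<lambda>t. r * t) ` N) / Inf ((\<lambda>t. r * t) ` N) = matrix_distortion A" if "r > 0" for r
  proof -
    have bd: "bdd_above N" "bdd_below N"
      by (simp_all add: comp compact_imp_bounded bounded_imp_bdd_above bounded_imp_bdd_below)
    have m: "mono (\<lambda>t::real. r * t)" using that by (auto simp: mono_def)
    have "r * Sup N = Sup ((\<lambda>t. r * t) ` N)"
      by (rule continuous_at_Sup_mono[OF m _ ne bd(1)]) (intro continuous_intros)
    moreover have "r * Inf N = Inf ((\<lambda>t. r * t) ` N)"
      by (rule continuous_at_Inf_mono[OF m _ ne bd(2)]) (intro continuous_intros)
    ultimately show ?thesis
      using that unfolding matrix_distortion_def N_def[symmetric] by (metis less_irrefl mult_divide_mult_cancel_left)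
  qed
  have "Limsup (at_right 0) (\<lambda>r::real. ereal
       ((SUP h\<in>sphere 0 r. norm (A *v (x + h) - A *v x)) / (INF h\<in>sphere 0 r. norm (A *v (x + h) - A *v x))))
     = Limsup (at_right 0) (\<lambda>r::real. ereal (matrix_distortion A))"
    by (intro Limsup_eq eventually_at_rightI[of 0 1]) (simp_all add: img q)
  then show ?thesis
    unfolding linear_distortion_def by (simp add: Limsup_const)
qed

end

theory Submission
  imports Defs
begin

text \<open>
  The distortion of matrices fails to be rank-one convex where the singular values are distinct:
  there are vectors \<open>\<xi>, \<nu>\<close> such that both \<open>A + t \<xi> \<nu>\<^sup>T\<close> and \<open>A - t \<xi> \<nu>\<^sup>T\<close> have smaller distortion than
  \<open>A\<close> for all small \<open>t > 0\<close>.  Since no boundary values are prescribed, a simple laminate suffices: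
  \<open>f z = A z + (t / c) sawtooth (c (\<nu> \<bullet> z)) \<xi>\<close> has just these two gradients off a null set of
  parallel planes, is bilipschitz, and tends to \<open>A\<close> uniformly as \<open>c \<rightarrow> \<infinity>\<close>.  The strict monotonicity of
  \<open>\<Phi>\<close> then yields a gap \<open>\<delta>\<close> independent of \<open>c\<close>.
\<close>

subsection \<open>Rank-one perturbations of diagonal matrices\<close>

text \<open>For a symmetric operator the norm equals the numerical radius: polarization turns
  \<open>T x \<bullet> y\<close> into values of the quadratic form at \<open>x + y\<close> and
  \<open>x - y\<close>, and the parallelogram law adds up their bounds.\<close>

lemma norm_le_of_quadratic_form_bound:
  fixes T :: "'a::real_inner \<Rightarrow> 'a"
  assumes lin: "linear T" and sym: "\<And>x y. T x \<bullet> y = x \<bullet> T y"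
    and bound: "\<And>x. \<bar>x \<bullet> T x\<bar> \<le> c * (x \<bullet> x)"
  shows "norm (T x) \<le> c * norm x"
proof (cases "T x = 0 \<or> x = 0")
  case True
  have "0 \<le> c * (norm x)\<^sup>2"
    using bound[of x] by (simp add: power2_norm_eq_inner)
  then have "0 \<le> c * norm x"
    by (cases "x = 0") (auto simp: zero_le_mult_iff)
  with True lin show ?thesis
    by (auto simp: linear_0)
next
  case False
  \<comment> \<open>Aligning \<open>y\<close> with \<open>T x\<close> makes the inner product
    \<open>norm x * norm (T x)\<close>; giving it the length of \<open>x\<close> makes the
    parallelogram sum \<open>4 * (norm x)\<^sup>2\<close>.\<close>
  define y where "y = (norm x / norm (T x)) *\<^sub>R T x"
  have ny: "norm y = norm x"
    using False by (simp add: y_def)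
  have "4 * (T x \<bullet> y) = (x + y) \<bullet> T (x + y) - (x - y) \<bullet> T (x - y)"
    using sym[of x y] sym[of y x]
    by (simp add: linear_add[OF lin] linear_diff[OF lin] inner_add_left inner_add_right
        inner_diff_left inner_diff_right inner_commute algebra_simps)
  also have "\<dots> \<le> c * ((x + y) \<bullet> (x + y)) + c * ((x - y) \<bullet> (x - y))"
    using bound[of "x + y"] bound[of "x - y"] by linarith
  also have "\<dots> = c * (2 * (norm x)\<^sup>2 + 2 * (norm y)\<^sup>2)"
    by (simp add: power2_norm_eq_inner inner_add_left inner_add_right
        inner_diff_left inner_diff_right inner_commute algebra_simps)
  finally have "T x \<bullet> y \<le> c * (norm x)\<^sup>2"
    by (simp add: ny)
  moreover have "T x \<bullet> y = norm x * norm (T x)"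
    using False by (simp add: y_def power2_norm_eq_inner[symmetric] power2_eq_square)
  ultimately show ?thesis
    using False by (simp add: power2_eq_square)
qed

text \<open>Second-order perturbation theory of a simple top eigenvalue: under
  \<open>t v v^T\<close> the coefficient of \<open>t^2\<close> is the sum in the assumption, and a
  strictly larger \<alpha> absorbs the higher-order terms, for either sign of
  \<open>t\<close>.\<close>

lemma eventually_rank_one_quadratic_le:
  fixes d v :: "real^'n"
  assumes gap: "\<And>i. i \<noteq> k \<Longrightarrow> d$i < d$k"
    and \<alpha>: "(\<Sum>i\<in>UNIV - {k}. (v$k * v$i)\<^sup>2 / (d$k - d$i)) < \<alpha>"
  shows "\<forall>\<^sub>F t in nhds 0. \<forall>x. (\<Sum>i\<in>UNIV. d$i * (x$i)\<^sup>2) + t * (v \<bullet> x)\<^sup>2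
           \<le> (d$k + t * (v$k)\<^sup>2 + \<alpha> * t\<^sup>2) * (x \<bullet> x)"
proof -
  define I where "I = UNIV - {k}"
  \<comment> \<open>The spectral gap less a reserve \<open>\<bar>t\<bar> * (v \<bullet> v)\<close>,
    which later pays for \<open>t * r\<^sup>2\<close> and, if \<open>t\<close> is negative, for
    \<open>t * (v$k)\<^sup>2 * q\<close>.\<close>
  define g where "g t i = d$k - d$i - \<bar>t\<bar> * (v \<bullet> v)" for t i
  have \<alpha>0: "0 \<le> \<alpha>"
    using \<alpha> gap by (smt (verit) DiffE divide_nonneg_pos insertI1 sum_nonneg zero_le_power2)
  have "((\<lambda>t. \<Sum>i\<in>I. (v$k * v$i)\<^sup>2 / g t i)
          \<longlongrightarrow> (\<Sum>i\<in>I. (v$k * v$i)\<^sup>2 / (d$k - d$i - \<bar>0\<bar> * (v \<bullet> v)))) (nhds 0)"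
    unfolding g_def by (intro tendsto_intros filterlim_ident) (auto simp: I_def dest!: gap)
  then have ev1: "\<forall>\<^sub>F t in nhds 0. (\<Sum>i\<in>I. (v$k * v$i)\<^sup>2 / g t i) < \<alpha>"
    using \<alpha> by (intro order_tendstoD(2)) (auto simp: I_def)
  have ev2: "\<forall>\<^sub>F t in nhds 0. \<forall>i\<in>I. 0 < g t i"
  proof (rule eventually_ball_finite)
    show "\<forall>i\<in>I. \<forall>\<^sub>F t in nhds 0. 0 < g t i"
    proof
      fix i assume "i \<in> I"
      have "((\<lambda>t. g t i) \<longlongrightarrow> d$k - d$i - \<bar>0\<bar> * (v \<bullet> v)) (nhds 0)"
        unfolding g_def by (intro tendsto_intros filterlim_ident)
      then show "\<forall>\<^sub>F t in nhds 0. 0 < g t i"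
        using gap[of i] \<open>i \<in> I\<close> by (intro order_tendstoD(1)) (auto simp: I_def)
    qed
  qed (simp add: I_def)
  show ?thesis
    using ev1 ev2
  proof (eventually_elim, intro allI)
    fix t :: real and x :: "real^'n"
    assume t1: "(\<Sum>i\<in>I. (v$k * v$i)\<^sup>2 / g t i) < \<alpha>" and t2: "\<forall>i\<in>I. 0 < g t i"
    have split: "(\<Sum>i\<in>UNIV. F i) = F k + (\<Sum>i\<in>I. F i)" for F :: "'n \<Rightarrow> real"
      unfolding I_def by (simp add: sum.remove)
    define r where "r = (\<Sum>i\<in>I. v$i * x$i)"
    define q where "q = (\<Sum>i\<in>I. (x$i)\<^sup>2)"
    define V where "V = (\<Sum>i\<in>I. (v$i)\<^sup>2)"
    have q0: "0 \<le> q" unfolding q_def by (simp add: sum_nonneg)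
    have vx: "v \<bullet> x = v$k * x$k + r"
      unfolding inner_vec_def r_def by (simp add: split)
    have xx: "x \<bullet> x = (x$k)\<^sup>2 + q"
      unfolding inner_vec_def q_def by (simp add: split power2_eq_square)
    have vv: "v \<bullet> v = (v$k)\<^sup>2 + V"
      unfolding inner_vec_def V_def by (simp add: split power2_eq_square)
    have r2: "r\<^sup>2 \<le> V * q"
      unfolding r_def V_def q_def by (rule Cauchy_Schwarz_ineq_sum)
    \<comment> \<open>Young's inequality with weight \<open>g t i\<close>, by completing a square;
      after summation the coefficient of \<open>t\<^sup>2 * (x$k)\<^sup>2\<close> is the sum that
      \<open>t1\<close> keeps below \<alpha>.\<close>
    have amgm: "2 * t * (v$k * x$k) * (v$i * x$i)
        \<le> t\<^sup>2 * (x$k)\<^sup>2 * ((v$k * v$i)\<^sup>2 / g t i) + g t i * (x$i)\<^sup>2" if "i \<in> I" for i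
    proof -
      have gp: "0 < g t i" using t2 that by blast
      have "0 \<le> (t * x$k * v$k * v$i - g t i * x$i)\<^sup>2 / g t i"
        using gp by simp
      also have "\<dots> = t\<^sup>2 * (x$k)\<^sup>2 * ((v$k * v$i)\<^sup>2 / g t i) + g t i * (x$i)\<^sup>2
          - 2 * t * (v$k * x$k) * (v$i * x$i)"
        using gp by (simp add: field_simps power2_eq_square)
      finally show ?thesis by simp
    qed
    have "2 * t * (v$k * x$k) * r
        \<le> (\<Sum>i\<in>I. t\<^sup>2 * (x$k)\<^sup>2 * ((v$k * v$i)\<^sup>2 / g t i) + g t i * (x$i)\<^sup>2)"
      unfolding r_def sum_distrib_left by (rule sum_mono[OF amgm])
    also have "\<dots> = t\<^sup>2 * (x$k)\<^sup>2 * (\<Sum>i\<in>I. (v$k * v$i)\<^sup>2 / g t i) + (\<Sum>i\<in>I. g t i * (x$i)\<^sup>2)"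
      by (simp add: sum.distrib sum_distrib_left)
    also have "\<dots> \<le> t\<^sup>2 * (x$k)\<^sup>2 * \<alpha> + (\<Sum>i\<in>I. g t i * (x$i)\<^sup>2)"
      using t1 by (intro add_mono mult_left_mono) auto
    also have "(\<Sum>i\<in>I. g t i * (x$i)\<^sup>2)
        = (d$k - \<bar>t\<bar> * (v \<bullet> v)) * q - (\<Sum>i\<in>I. d$i * (x$i)\<^sup>2)"
      unfolding g_def q_def by (simp add: sum_distrib_left sum_subtractf[symmetric] algebra_simps)
    finally have cross: "2 * t * (v$k * x$k) * r
        \<le> t\<^sup>2 * (x$k)\<^sup>2 * \<alpha> + (d$k - \<bar>t\<bar> * (v \<bullet> v)) * q - (\<Sum>i\<in>I. d$i * (x$i)\<^sup>2)"
      by simp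
    have "t * r\<^sup>2 \<le> \<bar>t\<bar> * (V * q)"
      using r2 by (intro mult_mono) auto
    moreover have "- (t * (v$k)\<^sup>2 * q) \<le> \<bar>t\<bar> * (v$k)\<^sup>2 * q"
    proof -
      have "- t * ((v$k)\<^sup>2 * q) \<le> \<bar>t\<bar> * ((v$k)\<^sup>2 * q)"
        using q0 by (intro mult_right_mono) auto
      then show ?thesis by simp
    qed
    moreover have "0 \<le> \<alpha> * t\<^sup>2 * q"
      using \<alpha>0 q0 by simp
    ultimately show "(\<Sum>i\<in>UNIV. d$i * (x$i)\<^sup>2) + t * (v \<bullet> x)\<^sup>2
        \<le> (d$k + t * (v$k)\<^sup>2 + \<alpha> * t\<^sup>2) * (x \<bullet> x)"
      using cross unfolding split[of "\<lambda>i. d$i * (x$i)\<^sup>2"] vx xx vv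
      by (simp add: power2_sum algebra_simps)
  qed
qed

text \<open>As \<open>d$k\<close> dominates the other entries in absolute value, no negative
  eigenvalue competes with the top one for small \<open>t\<close>, so the quadratic bound becomes an
  operator norm bound.\<close>

lemma eventually_rank_one_norm_le:
  fixes d v :: "real^'n"
  assumes gap: "\<And>i. i \<noteq> k \<Longrightarrow> \<bar>d$i\<bar> < d$k" and pos: "0 < d$k"
    and \<alpha>: "(\<Sum>i\<in>UNIV - {k}. (v$k * v$i)\<^sup>2 / (d$k - d$i)) < \<alpha>"
  shows "\<forall>\<^sub>F t in nhds 0. \<forall>x. norm ((\<chi> i. d$i * x$i) + (t * (v \<bullet> x)) *\<^sub>R v)
           \<le> (d$k + t * (v$k)\<^sup>2 + \<alpha> * t\<^sup>2) * norm x"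
proof -
  define c where "c t = d$k + t * (v$k)\<^sup>2 + \<alpha> * t\<^sup>2" for t
  have ev1: "\<forall>\<^sub>F t in nhds 0. \<forall>x. (\<Sum>i\<in>UNIV. d$i * (x$i)\<^sup>2) + t * (v \<bullet> x)\<^sup>2 \<le> c t * (x \<bullet> x)"
    unfolding c_def using gap \<alpha> by (intro eventually_rank_one_quadratic_le) (auto simp: abs_less_iff)
  \<comment> \<open>This will keep the quadratic form above \<open>- c t * (x \<bullet> x)\<close>:
    at \<open>t = 0\<close> the margin is \<open>d$i + d$k\<close>, and
    \<open>\<bar>t\<bar> * (v \<bullet> v)\<close> covers the worst effect of the rank-one
    term.\<close>
  have ev2: "\<forall>\<^sub>F t in nhds 0. \<forall>i\<in>UNIV. 0 < d$i + c t - \<bar>t\<bar> * (v \<bullet> v)"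
  proof (rule eventually_ball_finite)
    show "\<forall>i\<in>UNIV. \<forall>\<^sub>F t in nhds 0. 0 < d$i + c t - \<bar>t\<bar> * (v \<bullet> v)"
    proof
      fix i
      have "((\<lambda>t. d$i + c t - \<bar>t\<bar> * (v \<bullet> v))
          \<longlongrightarrow> d$i + (d$k + 0 * (v$k)\<^sup>2 + \<alpha> * 0\<^sup>2) - \<bar>0\<bar> * (v \<bullet> v)) (nhds 0)"
        unfolding c_def by (intro tendsto_intros filterlim_ident)
      moreover have "0 < d$i + d$k"
        using gap[of i] pos by (cases "i = k") (auto simp: abs_less_iff)
      ultimately show "\<forall>\<^sub>F t in nhds 0. 0 < d$i + c t - \<bar>t\<bar> * (v \<bullet> v)"
        by (intro order_tendstoD(1)) auto
    qed
  qed simp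
  show ?thesis
    using ev1 ev2 unfolding c_def[symmetric]
  proof (eventually_elim, intro allI)
    fix t :: real and x :: "real^'n"
    assume t1: "\<forall>x. (\<Sum>i\<in>UNIV. d$i * (x$i)\<^sup>2) + t * (v \<bullet> x)\<^sup>2 \<le> c t * (x \<bullet> x)"
      and t2: "\<forall>i\<in>UNIV. 0 < d$i + c t - \<bar>t\<bar> * (v \<bullet> v)"
    define T where "T x = (\<chi> i. d$i * x$i) + (t * (v \<bullet> x)) *\<^sub>R v" for x
    have quad: "x \<bullet> T x = (\<Sum>i\<in>UNIV. d$i * (x$i)\<^sup>2) + t * (v \<bullet> x)\<^sup>2" for x
      by (simp add: T_def inner_add_right inner_commute[of x v] power2_eq_square)
         (simp add: inner_vec_def algebra_simps)
    have lower: "- (c t * (x \<bullet> x)) \<le> x \<bullet> T x" for x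
    proof -
      have "(\<bar>t\<bar> * (v \<bullet> v)) * (x \<bullet> x) \<le> (\<Sum>i\<in>UNIV. (d$i + c t) * (x$i)\<^sup>2)"
        unfolding inner_vec_def[of x x] sum_distrib_left
      proof (rule sum_mono)
        fix i
        have "\<bar>t\<bar> * (v \<bullet> v) * (x$i)\<^sup>2 \<le> (d$i + c t) * (x$i)\<^sup>2"
          using t2[rule_format, of i] by (intro mult_right_mono) auto
        then show "\<bar>t\<bar> * (v \<bullet> v) * (x$i \<bullet> x$i) \<le> (d$i + c t) * (x$i)\<^sup>2"
          by (simp add: power2_eq_square)
      qed
      also have "\<dots> = (\<Sum>i\<in>UNIV. d$i * (x$i)\<^sup>2) + c t * (x \<bullet> x)"
        by (simp add: inner_vec_def sum_distrib_left sum.distrib[symmetric] power2_eq_square algebra_simps)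
      finally have "(\<bar>t\<bar> * (v \<bullet> v)) * (x \<bullet> x) \<le> (\<Sum>i\<in>UNIV. d$i * (x$i)\<^sup>2) + c t * (x \<bullet> x)" .
      moreover have "\<bar>t\<bar> * (v \<bullet> x)\<^sup>2 \<le> \<bar>t\<bar> * ((v \<bullet> v) * (x \<bullet> x))"
        by (intro mult_left_mono Cauchy_Schwarz_ineq) auto
      moreover have "- (\<bar>t\<bar> * (v \<bullet> x)\<^sup>2) \<le> t * (v \<bullet> x)\<^sup>2"
        by (metis abs_ge_minus_self abs_mult abs_power2 minus_le_iff)
      ultimately show ?thesis unfolding quad by (simp add: mult.assoc)
    qed
    have "norm (T x) \<le> c t * norm x"
    proof (rule norm_le_of_quadratic_form_bound)
      show "linear T"
        unfolding T_def
        by (intro linearI) (simp_all add: vec_eq_iff inner_add_right algebra_simps)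
      show "T x \<bullet> y = x \<bullet> T y" for x y
        by (simp add: T_def inner_add_left inner_add_right inner_commute)
           (simp add: inner_vec_def algebra_simps)
      show "\<bar>x \<bullet> T x\<bar> \<le> c t * (x \<bullet> x)" for x
        using t1 lower[of x] quad[of x] by (auto simp: abs_le_iff)
    qed
    then show "norm ((\<chi> i. d$i * x$i) + (t * (v \<bullet> x)) *\<^sub>R v) \<le> c t * norm x"
      by (simp add: T_def)
  qed
qed


section \<open>Orthonormal frames and singular vectors\<close>

lemma orthonormal_coordinates:
  fixes y :: "'n::finite \<Rightarrow> real^'n"
  assumes norm1: "\<And>i. norm (y i) = 1" and orth: "\<And>i j. i \<noteq> j \<Longrightarrow> y i \<bullet> y j = 0"
  shows "norm (\<chi> i. y i \<bullet> x) = norm x" and "\<exists>z. \<forall>i. y i \<bullet> z = u$i"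
proof -
  define Q :: "real^'n^'n" where "Q = (\<chi> i. y i)"
  have Q: "orthogonal_matrix Q"
    unfolding orthogonal_matrix_orthonormal_rows
    using norm1 orth by (simp add: Q_def row_def orthogonal_def)
  have Qx: "Q *v x = (\<chi> i. y i \<bullet> x)" for x
    by (simp add: Q_def matrix_vector_mult_def inner_vec_def)
  have "(Q *v x) \<bullet> (Q *v x) = (transpose Q *v (Q *v x)) \<bullet> x"
    by (simp add: dot_lmul_matrix)
  also have "transpose Q *v (Q *v x) = x"
    using Q by (simp add: orthogonal_matrix_def matrix_vector_mul_assoc)
  finally show "norm (\<chi> i. y i \<bullet> x) = norm x"
    by (simp add: norm_eq Qx)
  have "Q *v (transpose Q *v u) = u"
    using Q by (simp add: orthogonal_matrix_def matrix_vector_mul_assoc del: transpose_matrix_vector)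
  then show "\<exists>z. \<forall>i. y i \<bullet> z = u$i"
    unfolding Qx by (metis vec_lambda_beta)
qed

text \<open>A singular value decomposition that bypasses the spectral theorem: since
  \<open>a\<close> is injective, one eigenvector of \<open>transpose A ** A\<close> per index
  already gives pairwise orthogonal vectors, and their rescaled images under \<open>A\<close> form
  the second frame.\<close>

lemma singular_vectors:
  fixes A :: "real^'n^'n" and a :: "'n \<Rightarrow> real"
  assumes inv: "invertible A" and inj: "inj a" and sv: "\<And>i. a i \<in> singular_values A"
  obtains w y :: "'n \<Rightarrow> real^'n"
  where "\<And>i. 0 < a i" "\<And>i. norm (w i) = 1" "\<And>i. norm (y i) = 1"
    "\<And>i j. i \<noteq> j \<Longrightarrow> w i \<bullet> w j = 0" "\<And>i j. i \<noteq> j \<Longrightarrow> y i \<bullet> y j = 0"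
    "\<And>i x. y i \<bullet> (A *v x) = a i * (w i \<bullet> x)" "\<And>i. A *v w i = a i *\<^sub>R y i"
proof -
  have "\<forall>i. \<exists>v. v \<noteq> 0 \<and> (transpose A ** A) *v v = (a i)\<^sup>2 *\<^sub>R v"
    using sv by (auto simp: singular_values_def)
  then obtain v where v0: "\<And>i. v i \<noteq> 0" and v: "\<And>i. (transpose A ** A) *v v i = (a i)\<^sup>2 *\<^sub>R v i"
    by metis
  define w where "w i = v i /\<^sub>R norm (v i)" for i
  have nw: "norm (w i) = 1" for i
    using v0 by (simp add: w_def)
  have w: "transpose A *v (A *v w i) = (a i)\<^sup>2 *\<^sub>R w i" for i
    using v[of i] by (simp add: w_def matrix_vector_mult_scaleR matrix_vector_mul_assoc[symmetric])
  have Aw: "(A *v w i) \<bullet> (A *v x) = (a i)\<^sup>2 * (w i \<bullet> x)" for i x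
  proof -
    have "(A *v w i) \<bullet> (A *v x) = (transpose A *v (A *v w i)) \<bullet> x"
      by (simp add: dot_lmul_matrix)
    then show ?thesis by (simp add: w del: transpose_matrix_vector)
  qed
  have a0: "0 < a i" for i
  proof -
    have "A *v w i \<noteq> A *v 0"
      using injD[OF inj_matrix_vector_mult[OF inv], of "w i" 0] nw[of i] by auto
    then have "0 < (A *v w i) \<bullet> (A *v w i)"
      by simp
    then show ?thesis
      using sv[of i] by (auto simp: Aw singular_values_def zero_less_mult_iff less_le)
  qed
  define y where "y i = (A *v w i) /\<^sub>R a i" for i
  have orth: "w i \<bullet> w j = 0" if "i \<noteq> j" for i j
  proof -
    have "(a i)\<^sup>2 * (w i \<bullet> w j) = (a j)\<^sup>2 * (w i \<bullet> w j)"
      using Aw[of i "w j"] Aw[of j "w i"] by (simp add: inner_commute)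
    \<comment> \<open>Positivity rules out \<open>a i = - a j\<close>, so distinct singular values
      have distinct squares.\<close>
    moreover have "(a i)\<^sup>2 \<noteq> (a j)\<^sup>2"
      using that inj a0[of i] a0[of j] by (auto simp: power2_eq_iff inj_def)
    ultimately show ?thesis by simp
  qed
  show thesis
  proof
    show "0 < a i" for i by (rule a0)
    show "norm (w i) = 1" for i by (rule nw)
    show "w i \<bullet> w j = 0" if "i \<noteq> j" for i j by (rule orth[OF that])
    show "A *v w i = a i *\<^sub>R y i" for i
      using a0[of i] by (simp add: y_def)
    show yA: "y i \<bullet> (A *v x) = a i * (w i \<bullet> x)" for i x
      using a0[of i] by (simp add: y_def Aw power2_eq_square)
    show "y i \<bullet> y j = 0" if "i \<noteq> j" for i j
      using yA[of i "w j"] orth[OF that] by (simp add: y_def)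
    have "(norm (y i))\<^sup>2 = 1" for i
      unfolding power2_norm_eq_inner using yA[of i "w i"] a0[of i] nw[of i]
      by (simp add: y_def norm_eq_1)
    then show "norm (y i) = 1" for i
      by (smt (verit) norm_ge_zero power2_eq_1_iff)
  qed
qed

section \<open>Second-order change of the ratio of the extreme singular values\<close>

text \<open>As \<open>- t / (1 + t * s)\<close> is \<open>- t + s t^2 + O(t^3)\<close>, the
  first-order terms cancel and the product is
  \<open>1 + (\<alpha> + \<beta> + s - 1) t^2 + O(t^3)\<close>.\<close>

lemma quotient_expansion_eventually_less:
  fixes \<alpha> \<beta> s :: real
  assumes "\<alpha> + \<beta> + s < 1"
  shows "\<forall>\<^sub>F t in at 0. (1 + t + \<alpha> * t\<^sup>2) * (1 + (- t / (1 + t * s)) + \<beta> * (- t / (1 + t * s))\<^sup>2) < 1"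
proof -
  \<comment> \<open>The exact cofactor: the product minus 1 equals
    \<open>t\<^sup>2 * g t / (1 + t * s)\<^sup>2\<close>, and
    \<open>g 0 = \<alpha> + \<beta> + s - 1\<close>.\<close>
  define g where "g t = \<alpha> * (1 + t * s)\<^sup>2 + 2 * s + s\<^sup>2 * t - 1 - \<alpha> * t + (1 + t + \<alpha> * t\<^sup>2) * (\<beta> - s)" for t
  have "(g \<longlongrightarrow> \<alpha> * (1 + 0 * s)\<^sup>2 + 2 * s + s\<^sup>2 * 0 - 1 - \<alpha> * 0 + (1 + 0 + \<alpha> * 0\<^sup>2) * (\<beta> - s)) (at 0)"
    unfolding g_def by (intro tendsto_intros)
  then have g: "\<forall>\<^sub>F t in at 0. g t < 0"
    using assms by (intro order_tendstoD(2)) auto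
  have "((\<lambda>t. 1 + t * s) \<longlongrightarrow> 1 + 0 * s) (at 0)"
    by (intro tendsto_intros)
  then have h: "\<forall>\<^sub>F t in at 0. 0 < 1 + t * s"
    by (intro order_tendstoD(1)) auto
  have "\<forall>\<^sub>F t in at (0::real). t \<noteq> 0"
    by (simp add: eventually_at_filter)
  with g h show ?thesis
  proof eventually_elim
    fix t :: real
    assume g: "g t < 0" and h: "0 < 1 + t * s" and t: "t \<noteq> 0"
    have "(1 + t + \<alpha> * t\<^sup>2) * (1 + (- t / (1 + t * s)) + \<beta> * (- t / (1 + t * s))\<^sup>2) - 1
        = t\<^sup>2 * g t / (1 + t * s)\<^sup>2"
      using h unfolding g_def
      by (simp add: divide_simps) (simp add: algebra_simps power2_eq_square)
    also have "\<dots> < 0"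
      using g h t by (intro divide_neg_pos mult_pos_neg) auto
    finally show "(1 + t + \<alpha> * t\<^sup>2) * (1 + (- t / (1 + t * s)) + \<beta> * (- t / (1 + t * s))\<^sup>2) < 1"
      by simp
  qed
qed

text \<open>
  Here \<open>v\<close> is \<open>u\<close> with its middle entry negated, so the map below, composed with that reflection, is the
  symmetric map \<open>diag(a\<^sub>1, -a\<^sub>2, a\<^sub>3) + t u u\<^sup>T\<close>; by the Sherman-Morrison formula its inverse is again
  diagonal plus \<open>\<tau> w w\<^sup>T\<close>, with \<open>\<tau> = -t / (1 + t s)\<close>.  The outer entries \<open>\<surd>a\<^sub>1\<close>, \<open>\<surd>a\<^sub>3\<close> of \<open>u\<close> make the
  first-order changes of the two extreme singular values proportional, so that they cancel in the
  ratio; the second-order term is \<open>(a\<^sub>1 + a\<^sub>3) / (a\<^sub>1 - a\<^sub>3) - k gap\<close>, negative for large \<open>k\<close>.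
\<close>

lemma diagonal_rank_one_condition_decreases:
  fixes a :: "real^3"
  assumes a: "0 < a$3" "a$3 < a$2" "a$2 < a$1"
  obtains u v :: "real^3" where "v \<noteq> 0"
    "\<forall>\<^sub>F t in at 0. \<exists>c c'. c * c' < a$1 / a$3 \<and>
      (\<forall>p. norm ((\<chi> i. a$i * p$i) + (t * (v \<bullet> p)) *\<^sub>R u) \<le> c * norm p \<and>
           norm p \<le> c' * norm ((\<chi> i. a$i * p$i) + (t * (v \<bullet> p)) *\<^sub>R u))"
proof -
  define gap where "gap = 1 / (a$2 + a$3) - 1 / (a$1 + a$2)"
  have gap: "0 < gap"
    using a by (simp add: gap_def frac_less2)
  \<comment> \<open>Chosen to make \<open>\<alpha>0 + \<beta>0 + s - 1\<close>, the second-order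
    coefficient, equal to -1.\<close>
  define k where "k = (1 + (a$1 + a$3) / (a$1 - a$3)) / gap"
  have k: "0 < k"
    using a gap by (auto simp: k_def intro!: divide_pos_pos add_pos_pos)
  \<comment> \<open>The inner product \<open>w \<bullet> u\<close> in the Sherman-Morrison
    denominator.\<close>
  define s where "s = 2 - k / a$2"
  \<comment> \<open>\<open>\<alpha>0\<close> and \<open>\<beta>0\<close> are the second-order
    coefficients of the top eigenvalues of the map and of its inverse, relative to the leading
    values \<open>a$1\<close> and \<open>1 / a$3\<close>.\<close>
  define \<alpha>0 where "\<alpha>0 = k / (a$1 + a$2) + a$3 / (a$1 - a$3)"
  define \<beta>0 where "\<beta>0 = a$3 * k / (a$2 * (a$2 + a$3)) + a$3 / (a$1 - a$3)"
  have less1: "\<alpha>0 + \<beta>0 + s < 1"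
  proof -
    have e1: "a$3 * k / (a$2 * (a$2 + a$3)) = k / a$2 - k / (a$2 + a$3)"
      using a by (simp add: field_simps)
    have e2: "(a$1 + a$3) / (a$1 - a$3) = 1 + 2 * (a$3 / (a$1 - a$3))"
      using a by (simp add: field_simps)
    have "k * gap = 1 + (a$1 + a$3) / (a$1 - a$3)"
      using gap by (simp add: k_def)
    then show ?thesis
      unfolding \<alpha>0_def \<beta>0_def s_def e1 e2 gap_def by (simp add: algebra_simps)
  qed
  \<comment> \<open>A third of the slack goes to each coefficient: the perturbation lemma wants
    strict upper bounds, and a third still remains.\<close>
  define \<eta> where "\<eta> = (1 - (\<alpha>0 + \<beta>0 + s)) / 3"
  define \<alpha> where "\<alpha> = \<alpha>0 + \<eta>"
  define \<beta> where "\<beta> = \<beta>0 + \<eta>"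
  have \<eta>: "0 < \<eta>" and \<alpha>\<beta>: "\<alpha> + \<beta> + s < 1"
    using less1 unfolding \<eta>_def \<alpha>_def \<beta>_def by (auto simp: field_simps)
  \<comment> \<open>The negated middle entry is decisive: with \<open>a$2\<close> and
    \<open>u = v\<close> instead, the terms in \<open>k\<close> would add up to
    \<open>k * (1 / (a$1 - a$2) + 1 / (a$2 - a$3))\<close>, which is positive, rather than to
    \<open>- k * gap\<close>.\<close>
  define d :: "real^3" where "d = vector [a$1, - a$2, a$3]"
  define e :: "real^3" where "e = vector [1 / a$1, - 1 / a$2, 1 / a$3]"
  define u :: "real^3" where "u = vector [sqrt (a$1), sqrt k, sqrt (a$3)]"
  define v :: "real^3" where "v = vector [sqrt (a$1), - sqrt k, sqrt (a$3)]"
  define w :: "real^3" where "w = (\<chi> i. e$i * u$i)"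
  define S where "S t q = (\<chi> i. d$i * q$i) + (t * (u \<bullet> q)) *\<^sub>R u" for t and q :: "real^3"
  define T where "T t q = (\<chi> i. e$i * q$i) + (t * (w \<bullet> q)) *\<^sub>R w" for t and q :: "real^3"
  define J where "J p = (vector [p$1, - p$2, p$3] :: real^3)" for p :: "real^3"
  define F where "F t p = (\<chi> i. a$i * p$i) + (t * (v \<bullet> p)) *\<^sub>R u" for t and p :: "real^3"
  note vec = d_def e_def u_def v_def w_def vector_3
  have compl: "UNIV - {1::3} = {2, 3}" "UNIV - {3::3} = {1, 2}"
    using exhaust_3 by auto
  have FS: "F t p = S t (J p)" for t p
    by (simp add: F_def S_def J_def vec vec_eq_iff forall_3 inner_vec_def sum_3)
  have nJ: "norm (J p) = norm p" for p
    by (simp add: norm_eq J_def inner_vec_def sum_3 vector_3)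
  have TS: "T (- t / (1 + t * s)) (S t q) = q" if "1 + t * s \<noteq> 0" for t q
  proof -
    have de: "e$i * d$i = 1" for i
      using a exhaust_3[of i] by (auto simp: vec)
    have "w \<bullet> u = s"
      using a k by (simp add: vec inner_vec_def sum_3 s_def)
    moreover have "w \<bullet> (\<chi> i. d$i * q$i) = u \<bullet> q"
      unfolding inner_vec_def w_def using de by (intro sum.cong) (auto simp: algebra_simps)
    ultimately have wS: "w \<bullet> S t q = (1 + t * s) * (u \<bullet> q)"
      by (simp add: S_def inner_add_right algebra_simps)
    have "(\<chi> i. e$i * S t q $ i) = q + (t * (u \<bullet> q)) *\<^sub>R w"
      using de by (simp add: S_def w_def vec_eq_iff algebra_simps)
    moreover have "- t / (1 + t * s) * ((1 + t * s) * (u \<bullet> q)) = - (t * (u \<bullet> q))"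
      using that by simp
    ultimately show ?thesis
      unfolding T_def wS by simp
  qed
  have evS: "\<forall>\<^sub>F t in at 0. \<forall>q. norm (S t q) \<le> (d$1 + t * (u$1)\<^sup>2 + (a$1 * \<alpha>) * t\<^sup>2) * norm q"
  proof -
    have "\<forall>\<^sub>F t in nhds 0. \<forall>q. norm (S t q) \<le> (d$1 + t * (u$1)\<^sup>2 + (a$1 * \<alpha>) * t\<^sup>2) * norm q"
      unfolding S_def
    proof (rule eventually_rank_one_norm_le)
      show "\<bar>d$i\<bar> < d$1" if "i \<noteq> 1" for i
        using that a exhaust_3[of i] by (auto simp: vec)
      show "0 < d$1" using a by (simp add: vec)
      have "(\<Sum>i\<in>UNIV - {1}. (u$1 * u$i)\<^sup>2 / (d$1 - d$i)) = a$1 * \<alpha>0"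
        using a k by (simp add: compl vec \<alpha>0_def power_mult_distrib algebra_simps)
      then show "(\<Sum>i\<in>UNIV - {1}. (u$1 * u$i)\<^sup>2 / (d$1 - d$i)) < a$1 * \<alpha>"
        using a \<eta> by (simp add: \<alpha>_def)
    qed
    then show ?thesis by (simp add: eventually_nhds_conv_at)
  qed
  have wsq: "(w$1)\<^sup>2 = 1 / a$1" "(w$2)\<^sup>2 = k / (a$2)\<^sup>2" "(w$3)\<^sup>2 = 1 / a$3"
  proof -
    have "(w$i)\<^sup>2 = (e$i)\<^sup>2 * (u$i)\<^sup>2" for i
      by (simp add: w_def power_mult_distrib)
    then show "(w$1)\<^sup>2 = 1 / a$1" "(w$2)\<^sup>2 = k / (a$2)\<^sup>2" "(w$3)\<^sup>2 = 1 / a$3"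
      using a k by (simp_all add: vec power_divide power2_eq_square[of "a$1"] power2_eq_square[of "a$3"])
  qed
  have evT: "\<forall>\<^sub>F t in nhds 0. \<forall>q. norm (T t q) \<le> (e$3 + t * (w$3)\<^sup>2 + (\<beta> / a$3) * t\<^sup>2) * norm q"
    unfolding T_def
  proof (rule eventually_rank_one_norm_le)
    show "\<bar>e$i\<bar> < e$3" if "i \<noteq> 3" for i
      using that a exhaust_3[of i] by (auto simp: vec frac_less2)
    show "0 < e$3" using a by (simp add: vec)
    have "(w$3 * w$1)\<^sup>2 / (e$3 - e$1) = (a$3 / (a$1 - a$3)) / a$3"
    proof -
      have "(w$3 * w$1)\<^sup>2 = 1 / (a$3 * a$1)"
        by (simp add: power_mult_distrib wsq)
      moreover have "e$3 - e$1 = (a$1 - a$3) / (a$3 * a$1)"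
        using a by (simp add: vec field_simps)
      ultimately show ?thesis using a by simp
    qed
    moreover have "(w$3 * w$2)\<^sup>2 / (e$3 - e$2) = (a$3 * k / (a$2 * (a$2 + a$3))) / a$3"
    proof -
      have "(w$3 * w$2)\<^sup>2 = k / (a$3 * (a$2)\<^sup>2)"
        by (simp add: power_mult_distrib wsq)
      moreover have "e$3 - e$2 = (a$2 + a$3) / (a$3 * a$2)"
        using a by (simp add: vec field_simps)
      ultimately show ?thesis using a by (simp add: power2_eq_square)
    qed
    ultimately have "(\<Sum>i\<in>UNIV - {3}. (w$3 * w$i)\<^sup>2 / (e$3 - e$i)) = \<beta>0 / a$3"
      by (simp add: compl \<beta>0_def add_divide_distrib)
    then show "(\<Sum>i\<in>UNIV - {3}. (w$3 * w$i)\<^sup>2 / (e$3 - e$i)) < \<beta> / a$3"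
      using a \<eta> by (simp add: \<beta>_def divide_strict_right_mono)
  qed
  \<comment> \<open>The estimate for the inverse holds in its own parameter, so it is pulled back
    along this substitution, which tends to 0.\<close>
  have "((\<lambda>t. - t / (1 + t * s)) \<longlongrightarrow> - 0 / (1 + 0 * s)) (at 0)"
    by (intro tendsto_intros) auto
  then have evT': "\<forall>\<^sub>F t in at 0. \<forall>q. norm (T (- t / (1 + t * s)) q) \<le>
      (e$3 + (- t / (1 + t * s)) * (w$3)\<^sup>2 + (\<beta> / a$3) * (- t / (1 + t * s))\<^sup>2) * norm q"
    using evT by (auto dest: eventually_compose_filterlim)
  have "((\<lambda>t. 1 + t * s) \<longlongrightarrow> 1 + 0 * s) (at 0)"
    by (intro tendsto_intros)
  then have h: "\<forall>\<^sub>F t in at 0. 0 < 1 + t * s"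
    by (intro order_tendstoD(1)) auto
  have "\<forall>\<^sub>F t in at 0. \<exists>c c'. c * c' < a$1 / a$3 \<and>
      (\<forall>p. norm (F t p) \<le> c * norm p \<and> norm p \<le> c' * norm (F t p))"
    using evS evT' h quotient_expansion_eventually_less[OF \<alpha>\<beta>]
  proof eventually_elim
    fix t :: real
    define \<tau> where "\<tau> = - t / (1 + t * s)"
    assume S: "\<forall>q. norm (S t q) \<le> (d$1 + t * (u$1)\<^sup>2 + (a$1 * \<alpha>) * t\<^sup>2) * norm q"
      and T: "\<forall>q. norm (T (- t / (1 + t * s)) q) \<le>
        (e$3 + (- t / (1 + t * s)) * (w$3)\<^sup>2 + (\<beta> / a$3) * (- t / (1 + t * s))\<^sup>2) * norm q"
      and h: "0 < 1 + t * s"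
      and q: "(1 + t + \<alpha> * t\<^sup>2) * (1 + (- t / (1 + t * s)) + \<beta> * (- t / (1 + t * s))\<^sup>2) < 1"
    define c where "c = a$1 * (1 + t + \<alpha> * t\<^sup>2)"
    define c' where "c' = (1 + \<tau> + \<beta> * \<tau>\<^sup>2) / a$3"
    have "c * c' = (a$1 / a$3) * ((1 + t + \<alpha> * t\<^sup>2) * (1 + \<tau> + \<beta> * \<tau>\<^sup>2))"
      by (simp add: c_def c'_def)
    also have "\<dots> < (a$1 / a$3) * 1"
      using q a unfolding \<tau>_def by (intro mult_strict_left_mono) auto
    finally have "c * c' < a$1 / a$3" by simp
    moreover have "norm (F t p) \<le> c * norm p" for p
    proof -
      have "d$1 + t * (u$1)\<^sup>2 + (a$1 * \<alpha>) * t\<^sup>2 = c"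
        using a by (simp add: vec c_def algebra_simps)
      then show ?thesis using S[rule_format, of "J p"] by (simp add: FS nJ)
    qed
    moreover have "norm p \<le> c' * norm (F t p)" for p
    proof -
      have "e$3 + \<tau> * (w$3)\<^sup>2 + (\<beta> / a$3) * \<tau>\<^sup>2 = c'"
        unfolding wsq by (simp add: vec c'_def add_divide_distrib)
      moreover have "T \<tau> (S t (J p)) = J p"
        unfolding \<tau>_def using h by (intro TS) simp
      ultimately show ?thesis
        using T[rule_format, of "S t (J p)"] unfolding \<tau>_def[symmetric] by (simp add: FS nJ)
    qed
    ultimately show "\<exists>c c'. c * c' < a$1 / a$3 \<and>
      (\<forall>p. norm (F t p) \<le> c * norm p \<and> norm p \<le> c' * norm (F t p))"
      by blast
  qed
  moreover have "v \<noteq> 0"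
    using a by (auto simp: vec vec_eq_iff forall_3)
  ultimately show thesis
    using that unfolding F_def by blast
qed

subsection \<open>Distortion of matrices\<close>

text \<open>The constants bound the norms of \<open>B\<close> and of its inverse. The lower bound 1
  will keep the arguments of \<Phi> in the half-line where it is monotone.\<close>

lemma matrix_distortion_bounds:
  fixes B :: "real^'n^'n"
  assumes c: "\<And>p. norm (B *v p) \<le> c * norm p" and c': "\<And>p. norm p \<le> c' * norm (B *v p)"
  shows "matrix_distortion B \<le> c * c'" and "1 \<le> matrix_distortion B"
proof -
  obtain b :: "real^'n" where "b \<in> Basis" by (meson nonempty_Basis ex_in_conv)
  then have b: "b \<in> sphere 0 1" by simp
  then have ne: "sphere (0::real^'n) 1 \<noteq> {}" by blast
  have "1 \<le> c' * norm (B *v b)" using c'[of b] b by simp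
  then have c'0: "0 < c'"
    by (smt (verit) mult_nonpos_nonneg norm_ge_zero)
  have c0: "0 \<le> c"
    using c[of b] b by (simp add: order_trans[OF norm_ge_zero])
  have up: "norm (B *v p) \<le> c" if "p \<in> sphere 0 1" for p
    using c[of p] that by simp
  have lo: "1 / c' \<le> norm (B *v p)" if "p \<in> sphere 0 1" for p
    using c'[of p] that c'0 by (simp add: field_simps)
  have inf: "1 / c' \<le> (INF p\<in>sphere 0 1. norm (B *v p))"
    using ne lo by (intro cINF_greatest)
  have sup: "(SUP p\<in>sphere 0 1. norm (B *v p)) \<le> c"
    using ne up by (intro cSUP_least)
  have "matrix_distortion B \<le> c / (1 / c')"
    unfolding matrix_distortion_def using inf sup c'0 c0 by (intro frac_le) auto
  then show "matrix_distortion B \<le> c * c'" by simp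
  have "(INF p\<in>sphere 0 1. norm (B *v p)) \<le> norm (B *v b)"
    using b by (intro cINF_lower bdd_belowI2[where m = 0]) auto
  also have "\<dots> \<le> (SUP p\<in>sphere 0 1. norm (B *v p))"
    using b up by (intro cSUP_upper bdd_aboveI2) auto
  finally show "1 \<le> matrix_distortion B"
    unfolding matrix_distortion_def using inf c'0
    by (smt (verit) divide_pos_pos le_divide_eq_1_pos)
qed

lemma matrix_distortion_ge_ratio:
  fixes B :: "real^'n^'n"
  assumes inv: "invertible B" and p: "norm p = 1" and q: "norm q = 1"
  shows "norm (B *v p) / norm (B *v q) \<le> matrix_distortion B"
proof -
  obtain m where m: "m > 0" "\<And>x. m * norm x \<le> norm (B *v x)"
    using linear_inj_bounded_below_pos[OF matrix_vector_mul_linear inj_matrix_vector_mult[OF inv]] by blast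
  have "norm (B *v q) \<ge> (INF p\<in>sphere 0 1. norm (B *v p))"
    using q by (intro cINF_lower bdd_belowI2[where m = 0]) auto
  moreover have "m \<le> (INF p\<in>sphere 0 1. norm (B *v p))"
    using p m(2) by (intro cINF_greatest) (auto, metis mult.right_neutral)
  moreover have "bdd_above ((\<lambda>p. norm (B *v p)) ` sphere 0 1)"
    by (intro bounded_imp_bdd_above compact_imp_bounded compact_continuous_image continuous_intros compact_sphere)
  then have "norm (B *v p) \<le> (SUP p\<in>sphere 0 1. norm (B *v p))"
    using p by (intro cSUP_upper) auto
  ultimately show ?thesis
    unfolding matrix_distortion_def using m(1) by (intro frac_le) (auto intro: order_trans[OF norm_ge_zero])
qed

definition rank_one_perturbation :: "real^'n^'n \<Rightarrow> real^'n \<Rightarrow> real^'n \<Rightarrow> real \<Rightarrow> real^'n^'n" where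
  "rank_one_perturbation A \<xi> \<nu> t = (\<chi> i j. A$i$j + t * \<xi>$i * \<nu>$j)"

lemma rank_one_perturbation_mult:
  "rank_one_perturbation A \<xi> \<nu> t *v x = A *v x + (t * (\<nu> \<bullet> x)) *\<^sub>R \<xi>"
  by (simp add: rank_one_perturbation_def vec_eq_iff matrix_vector_mult_def inner_vec_def
      sum_distrib_left sum_distrib_right sum.distrib algebra_simps)

text \<open>In the singular frames \<open>w\<close> (domain) and \<open>y\<close> (target)
  \<open>A\<close> becomes diagonal, and vectors with coordinates \<open>v\<close> and
  \<open>u\<close> turn the diagonal perturbation into one of \<open>A\<close>. Orthonormality
  preserves all norms, hence the bounds on the distortion. The two-sided filter at 0 yields the
  gradients for \<open>t\<close> and \<open>- t\<close> together.\<close>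

lemma rank_one_perturbation_decreases_distortion:
  fixes A :: "real^3^3"
  assumes inv: "invertible A" and card: "card (singular_values A) = 3"
  obtains \<xi> \<nu> where "\<nu> \<noteq> 0"
    "\<forall>\<^sub>F t in at 0. 1 \<le> matrix_distortion (rank_one_perturbation A \<xi> \<nu> t) \<and>
       matrix_distortion (rank_one_perturbation A \<xi> \<nu> t) < matrix_distortion A"
proof -
  have "\<exists>a1 a2 a3. {a1, a2, a3} \<subseteq> singular_values A \<and> a3 < a2 \<and> a2 < a1"
  proof -
    obtain x y z where S: "singular_values A = {x, y, z}" and "x \<noteq> y" "y \<noteq> z" "x \<noteq> z"
      using card by (auto simp: card_3_iff)
    then consider "x < y \<and> y < z" | "x < z \<and> z < y" | "y < x \<and> x < z" | "y < z \<and> z < x"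
      | "z < x \<and> x < y" | "z < y \<and> y < x"
      by linarith
    then show ?thesis
      unfolding S by cases blast+
  qed
  then obtain a1 a2 a3 where sub: "{a1, a2, a3} \<subseteq> singular_values A" and less: "a3 < a2" "a2 < a1"
    by blast
  define a :: "real^3" where "a = vector [a1, a2, a3]"
  have a_sv: "a$i \<in> singular_values A" for i
    using sub exhaust_3[of i] by (auto simp: a_def vector_3)
  have "inj (\<lambda>i. a$i)"
    unfolding inj_def forall_3 using less by (auto simp: a_def vector_3)
  from singular_vectors[OF inv this a_sv] obtain w y where
    pos: "\<And>i. 0 < a$i" and w1: "\<And>i. norm (w i) = 1" and y1: "\<And>i. norm (y i) = 1"
    and w2: "\<And>i j. i \<noteq> j \<Longrightarrow> w i \<bullet> w j = 0" and y2: "\<And>i j. i \<noteq> j \<Longrightarrow> y i \<bullet> y j = 0"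
    and yA: "\<And>i x. y i \<bullet> (A *v x) = a$i * (w i \<bullet> x)" and Aw: "\<And>i. A *v w i = a$i *\<^sub>R y i"
    by metis
  have "0 < a$3" "a$3 < a$2" "a$2 < a$1"
    using pos[of 3] less by (auto simp: a_def vector_3)
  from diagonal_rank_one_condition_decreases[OF this] obtain u v :: "real^3" where v0: "v \<noteq> 0" and
    ev: "\<forall>\<^sub>F t in at 0. \<exists>c c'. c * c' < a$1 / a$3 \<and>
      (\<forall>p. norm ((\<chi> i. a$i * p$i) + (t * (v \<bullet> p)) *\<^sub>R u) \<le> c * norm p \<and>
           norm p \<le> c' * norm ((\<chi> i. a$i * p$i) + (t * (v \<bullet> p)) *\<^sub>R u))" .
  obtain \<xi> where \<xi>: "\<And>i. y i \<bullet> \<xi> = u$i"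
    using orthonormal_coordinates(2)[of y, OF y1 y2] by metis
  define \<nu> where "\<nu> = (\<Sum>i\<in>UNIV. v$i *\<^sub>R w i)"
  have \<nu>: "\<nu> \<bullet> x = v \<bullet> (\<chi> i. w i \<bullet> x)" for x
    by (simp add: \<nu>_def inner_sum_left inner_vec_def[of v])
  \<comment> \<open>The unit vectors \<open>w 1\<close> and \<open>w 3\<close> are stretched by
    exactly \<open>a$1\<close> and \<open>a$3\<close>.\<close>
  have "a$1 / a$3 \<le> matrix_distortion A"
    using matrix_distortion_ge_ratio[OF inv w1[of 1] w1[of 3]] pos[of 1] pos[of 3] y1 by (simp add: Aw)
  have "\<nu> \<noteq> 0"
  proof
    assume "\<nu> = 0"
    obtain x where "\<And>i. w i \<bullet> x = v$i"
      using orthonormal_coordinates(2)[of w, OF w1 w2] by metis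
    then have "\<nu> \<bullet> x = v \<bullet> v" by (simp add: \<nu>)
    with v0 \<open>\<nu> = 0\<close> show False by simp
  qed
  moreover have "\<forall>\<^sub>F t in at 0. 1 \<le> matrix_distortion (rank_one_perturbation A \<xi> \<nu> t) \<and>
       matrix_distortion (rank_one_perturbation A \<xi> \<nu> t) < matrix_distortion A"
    using ev
  proof eventually_elim
    fix t :: real
    assume "\<exists>c c'. c * c' < a$1 / a$3 \<and>
      (\<forall>p. norm ((\<chi> i. a$i * p$i) + (t * (v \<bullet> p)) *\<^sub>R u) \<le> c * norm p \<and>
           norm p \<le> c' * norm ((\<chi> i. a$i * p$i) + (t * (v \<bullet> p)) *\<^sub>R u))"
    then obtain c c' where cc: "c * c' < a$1 / a$3"
      and c: "\<And>p. norm ((\<chi> i. a$i * p$i) + (t * (v \<bullet> p)) *\<^sub>R u) \<le> c * norm p"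
      and c': "\<And>p. norm p \<le> c' * norm ((\<chi> i. a$i * p$i) + (t * (v \<bullet> p)) *\<^sub>R u)"
      by blast
    define B where "B = rank_one_perturbation A \<xi> \<nu> t"
    have nB: "norm (B *v x) = norm ((\<chi> i. a$i * (\<chi> i. w i \<bullet> x)$i) + (t * (v \<bullet> (\<chi> i. w i \<bullet> x))) *\<^sub>R u)" for x
    proof -
      have "norm (B *v x) = norm (\<chi> i. y i \<bullet> (B *v x))"
        by (rule orthonormal_coordinates(1)[of y, OF y1 y2, symmetric])
      also have "(\<chi> i. y i \<bullet> (B *v x)) = (\<chi> i. a$i * (\<chi> i. w i \<bullet> x)$i) + (t * (v \<bullet> (\<chi> i. w i \<bullet> x))) *\<^sub>R u"
        by (simp add: B_def rank_one_perturbation_mult vec_eq_iff inner_add_right yA \<xi> \<nu>)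
      finally show ?thesis .
    qed
    have nw: "norm (\<chi> i. w i \<bullet> x) = norm x" for x
      by (rule orthonormal_coordinates(1)[of w, OF w1 w2])
    have "norm (B *v x) \<le> c * norm x" "norm x \<le> c' * norm (B *v x)" for x
      using c[of "\<chi> i. w i \<bullet> x"] c'[of "\<chi> i. w i \<bullet> x"] unfolding nB nw by auto
    from matrix_distortion_bounds[OF this]
    show "1 \<le> matrix_distortion (rank_one_perturbation A \<xi> \<nu> t) \<and>
       matrix_distortion (rank_one_perturbation A \<xi> \<nu> t) < matrix_distortion A"
      using cc \<open>a$1 / a$3 \<le> matrix_distortion A\<close> by (simp add: B_def)
  qed
  ultimately show thesis using that by blast
qed

subsection \<open>Bilipschitz maps and laminates\<close>

lemma linear_distortion_locally_affine:
  fixes B :: "real^'n^'n"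
  assumes e: "0 < e" and f: "\<And>h. norm h < e \<Longrightarrow> f (x + h) - f x = B *v h"
  shows "linear_distortion x f = ereal (matrix_distortion B)"
proof -
  have "linear_distortion x f = linear_distortion x (\<lambda>z. B *v z)"
    unfolding linear_distortion_def
  proof (intro Limsup_eq eventually_at_rightI[of 0 e] e)
    fix r assume "r \<in> {0<..<e}"
    then have "norm (f (x + h) - f x) = norm (B *v (x + h) - B *v x)" if "h \<in> sphere 0 r" for h
      using f[of h] that by (simp add: matrix_vector_right_distrib)
    then show "ereal ((SUP h\<in>sphere 0 r. norm (f (x + h) - f x)) / (INF h\<in>sphere 0 r. norm (f (x + h) - f x)))
        = ereal ((SUP h\<in>sphere 0 r. norm (B *v (x + h) - B *v x)) /
                 (INF h\<in>sphere 0 r. norm (B *v (x + h) - B *v x)))"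
      by simp
  qed
  then show ?thesis by (simp add: linear_distortion_matrix)
qed

text \<open>All displacements on a sphere of radius \<open>r\<close> lie between
  \<open>m * r\<close> and \<open>L * r\<close>, so every quotient is at most
  \<open>L / m\<close>.\<close>

lemma bilipschitz_imp_quasiconformal_on:
  fixes f :: "'a::euclidean_space \<Rightarrow> 'a"
  assumes m: "0 < m" and lower: "\<And>x y. m * norm (x - y) \<le> norm (f x - f y)"
    and upper: "\<And>x y. norm (f x - f y) \<le> L * norm (x - y)"
  shows "quasiconformal_on \<Omega> f"
proof -
  have inj: "inj_on f \<Omega>"
  proof (rule inj_onI)
    fix x y assume "f x = f y"
    then show "x = y"
      using lower[of x y] m by (simp add: mult_le_0_iff)
  qed
  obtain b :: 'a where b: "b \<in> Basis" by (meson nonempty_Basis ex_in_conv)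
  have L0: "0 \<le> L"
    using upper[of b 0] b by (simp add: order_trans[OF norm_ge_zero])
  have "L-lipschitz_on \<Omega> f"
    using L0 upper by (intro lipschitz_onI) (auto simp: dist_norm)
  moreover have "(1 / m)-lipschitz_on (f ` \<Omega>) (inv_into \<Omega> f)"
  proof (rule lipschitz_onI)
    fix p q assume "p \<in> f ` \<Omega>" "q \<in> f ` \<Omega>"
    then obtain x y where "x \<in> \<Omega>" "p = f x" "y \<in> \<Omega>" "q = f y" by blast
    then show "dist (inv_into \<Omega> f p) (inv_into \<Omega> f q) \<le> 1 / m * dist p q"
      using lower[of x y] inj m by (simp add: dist_norm field_simps)
  qed (use m in simp)
  ultimately have "homeomorphism \<Omega> (f ` \<Omega>) f (inv_into \<Omega> f)"
    using inj by (intro homeomorphismI) (auto intro: lipschitz_on_continuous_on)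
  moreover have "linear_distortion x f \<le> ereal (L / m)" for x
    unfolding linear_distortion_def
  proof (intro Limsup_bounded eventually_at_rightI[of 0 1])
    fix r :: real assume "r \<in> {0<..<1}"
    then have r: "0 < r" by simp
    have "r *\<^sub>R b \<in> sphere 0 r" using b r by simp
    then have ne: "sphere (0::'a) r \<noteq> {}" by blast
    have "m * r \<le> (INF h\<in>sphere 0 r. norm (f (x + h) - f x))"
      using ne lower[of "x + h" x for h] by (intro cINF_greatest) auto
    moreover have "(SUP h\<in>sphere 0 r. norm (f (x + h) - f x)) \<le> L * r"
      using ne upper[of "x + h" x for h] by (intro cSUP_least) auto
    ultimately have "(SUP h\<in>sphere 0 r. norm (f (x + h) - f x)) / (INF h\<in>sphere 0 r. norm (f (x + h) - f x))
        \<le> (L * r) / (m * r)"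
      using L0 m r by (intro frac_le) auto
    then show "ereal ((SUP h\<in>sphere 0 r. norm (f (x + h) - f x)) / (INF h\<in>sphere 0 r. norm (f (x + h) - f x)))
        \<le> ereal (L / m)"
      using r by simp
  qed simp
  ultimately show ?thesis
    unfolding quasiconformal_on_def by blast
qed

section \<open>The sawtooth function and the laminate\<close>

text \<open>The distance to the nearest integer, a 1-periodic function with slopes 1 and -1.\<close>

definition sawtooth :: "real \<Rightarrow> real" where
  "sawtooth x = \<bar>x - of_int (round x)\<bar>"

lemma sawtooth_le: "sawtooth x \<le> 1 / 2"
  unfolding sawtooth_def using of_int_round_abs_le[of x] by (simp add: abs_minus_commute)

lemma sawtooth_nonneg: "0 \<le> sawtooth x"
  by (simp add: sawtooth_def)

text \<open>A distance to a set is 1-Lipschitz: the integer nearest to one point is a competitor for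
  the other.\<close>

lemma sawtooth_lipschitz: "\<bar>sawtooth x - sawtooth y\<bar> \<le> \<bar>x - y\<bar>"
  using round_diff_minimal[of x "round y"] round_diff_minimal[of y "round x"]
  unfolding sawtooth_def by linarith

text \<open>The kinks are the integers and the midpoints between them, that is, the points where
  \<open>2 * x\<close> is an integer.\<close>

lemma sawtooth_locally_affine:
  assumes "2 * x \<notin> \<int>"
  obtains e where "0 < e"
    "\<And>h. \<bar>h\<bar> < e \<Longrightarrow> sawtooth (x + h) - sawtooth x = (if of_int (round x) < x then h else - h)"
proof -
  define D where "D = \<bar>x - of_int (round x)\<bar>"
  have "D \<noteq> 0"
  proof
    assume "D = 0"
    then have "2 * x = of_int (2 * round x)" by (simp add: D_def)
    with assms show False by (metis Ints_of_int)
  qed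
  moreover have "D \<noteq> 1 / 2"
  proof
    assume "D = 1 / 2"
    then have "2 * x = of_int (2 * round x + 1) \<or> 2 * x = of_int (2 * round x - 1)"
      unfolding D_def by (auto simp: abs_if split: if_splits)
    with assms show False by (metis Ints_of_int)
  qed
  moreover have "0 \<le> D" "D \<le> 1 / 2"
    using sawtooth_le[of x] by (auto simp: D_def sawtooth_def)
  ultimately have D: "0 < D" "D < 1 / 2" by auto
  show thesis
  proof
    \<comment> \<open>Moving less than \<open>D\<close> stays on the same side of the nearest
      integer; moving less than \<open>1 / 2 - D\<close> keeps that integer the nearest.\<close>
    show "0 < min D (1 / 2 - D)" using D by simp
    fix h assume h: "\<bar>h\<bar> < min D (1 / 2 - D)"
    then have "\<bar>x + h - of_int (round x)\<bar> < 1 / 2"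
      unfolding D_def by linarith
    then have "round (x + h) = round x" by (rule round_unique')
    then show "sawtooth (x + h) - sawtooth x = (if of_int (round x) < x then h else - h)"
      using h D unfolding sawtooth_def D_def by auto
  qed
qed

text \<open>The factor \<open>t / c\<close> cancels the frequency \<open>c\<close> in the gradient,
  which is thus independent of \<open>c\<close>, while the amplitude is of order
  \<open>1 / c\<close>.\<close>

definition laminate :: "real^'n^'n \<Rightarrow> real^'n \<Rightarrow> real^'n \<Rightarrow> real \<Rightarrow> real \<Rightarrow> real^'n \<Rightarrow> real^'n" where
  "laminate A \<xi> \<nu> t c z = A *v z + (t / c * sawtooth (c * (\<nu> \<bullet> z))) *\<^sub>R \<xi>"

lemma laminate_near_linear:
  assumes "0 \<le> t" "0 < c"
  shows "norm (laminate A \<xi> \<nu> t c z - A *v z) \<le> t * norm \<xi> / c"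
proof -
  have "t / c * sawtooth (c * (\<nu> \<bullet> z)) \<le> t / c * 1"
    using assms sawtooth_le[of "c * (\<nu> \<bullet> z)"] by (intro mult_left_mono) auto
  then show ?thesis
    using assms by (simp add: laminate_def abs_mult sawtooth_nonneg)
      (metis mult.commute mult_right_mono norm_ge_zero times_divide_eq_right)
qed

text \<open>The oscillating term has Lipschitz constant at most
  \<open>t * (norm \<nu> * norm \<xi>)\<close> whatever \<open>c\<close> is, so it uses up at most
  half of the lower bound \<open>m\<close> of \<open>A\<close>.\<close>

lemma laminate_quasiconformal_on:
  fixes A :: "real^'n^'n"
  assumes m: "0 < m" "\<And>x. m * norm x \<le> norm (A *v x)"
    and t: "0 \<le> t" "t * (norm \<nu> * norm \<xi>) \<le> m / 2" and c: "0 < c"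
  shows "quasiconformal_on \<Omega> (laminate A \<xi> \<nu> t c)"
proof -
  obtain L where L: "\<And>x. norm (A *v x) \<le> norm x * L"
    using bounded_linear.bounded[OF matrix_vector_mul_bounded_linear] by metis
  define R where "R x y = (t / c * (sawtooth (c * (\<nu> \<bullet> x)) - sawtooth (c * (\<nu> \<bullet> y)))) *\<^sub>R \<xi>" for x y
  have diff: "laminate A \<xi> \<nu> t c x - laminate A \<xi> \<nu> t c y = A *v (x - y) + R x y" for x y
    by (simp add: laminate_def R_def matrix_vector_mult_diff_distrib algebra_simps)
  have R: "norm (R x y) \<le> m / 2 * norm (x - y)" for x y
  proof -
    have "\<bar>sawtooth (c * (\<nu> \<bullet> x)) - sawtooth (c * (\<nu> \<bullet> y))\<bar> \<le> \<bar>c * (\<nu> \<bullet> x) - c * (\<nu> \<bullet> y)\<bar>"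
      by (rule sawtooth_lipschitz)
    also have "\<dots> = c * \<bar>\<nu> \<bullet> (x - y)\<bar>"
      using c by (simp add: inner_diff_right abs_mult right_diff_distrib[symmetric])
    also have "\<dots> \<le> c * (norm \<nu> * norm (x - y))"
      using c by (intro mult_left_mono Cauchy_Schwarz_ineq2) auto
    finally have "norm (R x y) \<le> t / c * (c * (norm \<nu> * norm (x - y))) * norm \<xi>"
      unfolding R_def norm_scaleR abs_mult using t c by (intro mult_right_mono mult_mono) auto
    also have "\<dots> = t * (norm \<nu> * norm \<xi>) * norm (x - y)"
      using c by simp
    also have "\<dots> \<le> m / 2 * norm (x - y)"
      using t by (intro mult_right_mono) auto
    finally show ?thesis .
  qed
  show ?thesis
  proof (rule bilipschitz_imp_quasiconformal_on)
    show "0 < m / 2" using m by simp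
    show "m / 2 * norm (x - y) \<le> norm (laminate A \<xi> \<nu> t c x - laminate A \<xi> \<nu> t c y)" for x y
      unfolding diff using norm_diff_ineq[of "A *v (x - y)" "R x y"] m(2)[of "x - y"] R[of x y] by linarith
    show "norm (laminate A \<xi> \<nu> t c x - laminate A \<xi> \<nu> t c y) \<le> (L + m / 2) * norm (x - y)" for x y
      unfolding diff using norm_triangle_ineq[of "A *v (x - y)" "R x y"] L[of "x - y"] R[of x y]
      by (simp add: algebra_simps)
  qed
qed

lemma linear_distortion_laminate:
  fixes A :: "real^'n^'n"
  assumes c: "0 < c" and x: "2 * (c * (\<nu> \<bullet> x)) \<notin> \<int>"
  shows "linear_distortion x (laminate A \<xi> \<nu> t c) = ereal (matrix_distortion
    (rank_one_perturbation A \<xi> \<nu> (if of_int (round (c * (\<nu> \<bullet> x))) < c * (\<nu> \<bullet> x) then t else - t)))"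
proof -
  obtain e where e: "0 < e" and saw: "\<And>h. \<bar>h\<bar> < e \<Longrightarrow>
      sawtooth (c * (\<nu> \<bullet> x) + h) - sawtooth (c * (\<nu> \<bullet> x)) =
      (if of_int (round (c * (\<nu> \<bullet> x))) < c * (\<nu> \<bullet> x) then h else - h)"
    using sawtooth_locally_affine[OF x] by blast
  show ?thesis
  proof (rule linear_distortion_locally_affine)
    \<comment> \<open>Within this radius \<open>c * (\<nu> \<bullet> h)\<close> stays below
      \<open>e\<close>; adding 1 covers \<open>\<nu> = 0\<close>.\<close>
    show "0 < e / (c * (norm \<nu> + 1))"
      using c e by (intro divide_pos_pos mult_pos_pos add_nonneg_pos) auto
    fix h :: "real^'n" assume h: "norm h < e / (c * (norm \<nu> + 1))"
    have "\<bar>c * (\<nu> \<bullet> h)\<bar> \<le> c * (norm \<nu> * norm h)"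
      using c Cauchy_Schwarz_ineq2[of \<nu> h] by (simp add: abs_mult)
    also have "\<dots> \<le> c * (norm \<nu> + 1) * norm h"
      using c by (simp add: algebra_simps)
    also have "\<dots> < e"
      using h c by (simp add: pos_less_divide_eq add_nonneg_pos mult.commute)
    finally have "\<bar>c * (\<nu> \<bullet> h)\<bar> < e" .
    from saw[OF this]
    have saw_diff: "sawtooth (c * (\<nu> \<bullet> (x + h))) - sawtooth (c * (\<nu> \<bullet> x)) =
      (if of_int (round (c * (\<nu> \<bullet> x))) < c * (\<nu> \<bullet> x) then c * (\<nu> \<bullet> h) else - (c * (\<nu> \<bullet> h)))"
      by (simp add: inner_add_right distrib_left)
    have "laminate A \<xi> \<nu> t c (x + h) - laminate A \<xi> \<nu> t c x = A *v h +
       (t / c * (sawtooth (c * (\<nu> \<bullet> (x + h))) - sawtooth (c * (\<nu> \<bullet> x)))) *\<^sub>R \<xi>"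
      by (simp add: laminate_def matrix_vector_right_distrib algebra_simps)
    then show "laminate A \<xi> \<nu> t c (x + h) - laminate A \<xi> \<nu> t c x = rank_one_perturbation A \<xi> \<nu>
        (if of_int (round (c * (\<nu> \<bullet> x))) < c * (\<nu> \<bullet> x) then t else - t) *v h"
      unfolding saw_diff rank_one_perturbation_mult using c by simp
  qed
qed

lemma negligible_laminate_interfaces:
  fixes \<nu> :: "'a::euclidean_space"
  assumes "\<nu> \<noteq> 0" "0 < c"
  shows "negligible {x. 2 * (c * (\<nu> \<bullet> x)) \<in> \<int>}"
proof -
  have "{x. 2 * (c * (\<nu> \<bullet> x)) \<in> \<int>} = (\<Union>i::int. {x. ((2 * c) *\<^sub>R \<nu>) \<bullet> x = of_int i})"
    by (auto simp: Ints_def mult.assoc)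
  moreover have "negligible \<dots>"
  proof (rule negligible_countable_Union)
    fix S assume "S \<in> range (\<lambda>i::int. {x. ((2 * c) *\<^sub>R \<nu>) \<bullet> x = of_int i})"
    then obtain i :: int where "S = {x. ((2 * c) *\<^sub>R \<nu>) \<bullet> x = of_int i}" by blast
    moreover have "(2 * c) *\<^sub>R \<nu> \<noteq> 0" using assms by simp
    ultimately show "negligible S" using negligible_hyperplane by blast
  qed simp
  ultimately show ?thesis by simp
qed

section \<open>The uniform gap between the integrals\<close>

lemma set_integral_const:
  fixes k :: real
  assumes "\<Omega> \<in> lmeasurable"
  shows "(LINT x:\<Omega>|lebesgue. k) = measure lebesgue \<Omega> * k"
  using assms by (simp add: set_lebesgue_integral_def)

theorem theorem1:
  fixes \<Omega> :: "(real^3) set" and \<Phi> :: "real \<Rightarrow> real" and A :: "real^3^3"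
  assumes "open \<Omega>" and "connected \<Omega>" and "\<Omega> \<noteq> {}" and "bounded \<Omega>"
    and "convex_on {1..} \<Phi>" and "strict_mono_on {1..} \<Phi>"
    and "invertible A" and "card (singular_values A) = 3"
  shows "\<exists>\<delta>>0. \<forall>\<epsilon>>0. \<exists>f :: real^3 \<Rightarrow> real^3.
           quasiconformal_on \<Omega> f \<and>
           Linf_norm \<Omega> (\<lambda>z. f z - A *v z) < ereal \<epsilon> \<and>
           set_integrable lebesgue \<Omega> (\<lambda>x. \<Phi> (real_of_ereal (linear_distortion x f))) \<and>
           (LINT x:\<Omega>|lebesgue. \<Phi> (real_of_ereal (linear_distortion x f)))
             < (LINT x:\<Omega>|lebesgue. \<Phi> (matrix_distortion A)) - \<delta>"
proof -
  have meas: "\<Omega> \<in> lmeasurable"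
    using assms by (simp add: lmeasurable_open)
  have vol: "0 < measure lebesgue \<Omega>"
    using assms(1,3) meas by (metis negligible_iff_measure negligible_imp_measure0 open_not_negligible
        zero_less_measure_iff)
  obtain \<xi> \<nu> where \<nu>: "\<nu> \<noteq> 0" and
    ev: "\<forall>\<^sub>F t in at 0. 1 \<le> matrix_distortion (rank_one_perturbation A \<xi> \<nu> t) \<and>
       matrix_distortion (rank_one_perturbation A \<xi> \<nu> t) < matrix_distortion A"
    using rank_one_perturbation_decreases_distortion[OF assms(7,8)] by blast
  obtain d where d: "0 < d" and
    dec: "\<And>t. t \<noteq> 0 \<Longrightarrow> \<bar>t\<bar> < d \<Longrightarrow> 1 \<le> matrix_distortion (rank_one_perturbation A \<xi> \<nu> t) \<and>
       matrix_distortion (rank_one_perturbation A \<xi> \<nu> t) < matrix_distortion A"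
    using ev by (auto simp: eventually_at dist_real_def)
  obtain m where m: "m > 0" "\<And>x. m * norm x \<le> norm (A *v x)"
    using linear_inj_bounded_below_pos[OF matrix_vector_mul_linear inj_matrix_vector_mult[OF assms(7)]]
    by blast
  define K where "K = norm \<nu> * norm \<xi> + 1"
  have K: "0 < K" "norm \<nu> * norm \<xi> \<le> K" by (simp_all add: K_def add_nonneg_pos)
  \<comment> \<open>The first bound puts \<open>t\<close> and \<open>- t\<close> into the range
    where the distortion decreases; the second keeps the laminate bilipschitz.\<close>
  define t where "t = min (d / 2) (m / (2 * K))"
  have t: "0 < t" "t < d"
    using d m K by (auto simp: t_def min_def)
  have tK: "t * (norm \<nu> * norm \<xi>) \<le> m / 2"
  proof -
    have "t * (norm \<nu> * norm \<xi>) \<le> m / (2 * K) * K"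
      using K t by (intro mult_mono) (auto simp: t_def)
    then show ?thesis using K by simp
  qed
  define H where "H s = matrix_distortion (rank_one_perturbation A \<xi> \<nu> s)" for s
  define M where "M = max (H t) (H (- t))"
  have H1: "1 \<le> H t" "1 \<le> H (- t)" and M: "M < matrix_distortion A"
    using dec[of t] dec[of "- t"] t by (auto simp: H_def M_def)
  have \<Phi>mono: "\<Phi> (H t) \<le> \<Phi> M" "\<Phi> (H (- t)) \<le> \<Phi> M"
    using strict_mono_on_imp_mono_on[OF assms(6)] H1 by (auto simp: M_def mono_on_def)
  have \<Phi>less: "\<Phi> M < \<Phi> (matrix_distortion A)"
    using assms(6) M H1 by (auto simp: M_def strict_mono_on_def)
  \<comment> \<open>The integral drops by at least twice this amount; the factor 1/2 makes the final
    inequality strict. Nothing here depends on \<epsilon> or \<open>c\<close>.\<close>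
  define \<delta> where "\<delta> = measure lebesgue \<Omega> * (\<Phi> (matrix_distortion A) - \<Phi> M) / 2"
  have \<delta>: "0 < \<delta>"
    using vol \<Phi>less by (simp add: \<delta>_def)
  show ?thesis
  proof (intro exI[of _ \<delta>] conjI allI impI \<delta>)
    fix \<epsilon> :: real assume \<epsilon>: "0 < \<epsilon>"
    \<comment> \<open>Makes the deviation bound \<open>t * norm \<xi> / c\<close> smaller than
      \<epsilon>; the added 1 gives strictness and \<open>c > 0\<close> even if
      \<open>\<xi> = 0\<close>.\<close>
    define c where "c = (t * norm \<xi> + 1) / \<epsilon>"
    have c: "0 < c"
      using \<epsilon> t by (auto simp: c_def intro!: divide_pos_pos add_nonneg_pos)
    define f where "f = laminate A \<xi> \<nu> t c"
    define N where "N = {x. 2 * (c * (\<nu> \<bullet> x)) \<in> \<int>}"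
    have N: "negligible N"
      unfolding N_def by (rule negligible_laminate_interfaces[OF \<nu> c])
    \<comment> \<open>A two-valued Borel function agreeing with the integrand off the null set
      \<open>N\<close>. Measurability and integrability are proved for \<open>g\<close> and
      transferred, so the distortion on the interfaces is never computed.\<close>
    define g where "g x = (if of_int (round (c * (\<nu> \<bullet> x))) < c * (\<nu> \<bullet> x) then \<Phi> (H t) else \<Phi> (H (- t)))"
      for x
    have fg: "\<Phi> (real_of_ereal (linear_distortion x f)) = g x" if "x \<in> \<Omega> - N" for x
      using that linear_distortion_laminate[OF c, of \<nu> x A \<xi> t] by (auto simp: N_def f_def g_def H_def)
    have g_int: "g absolutely_integrable_on \<Omega>"
    proof (rule measurable_bounded_by_integrable_imp_absolutely_integrable)
      have "g \<in> borel_measurable borel"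
        unfolding g_def round_def by measurable
      then show "g \<in> borel_measurable (lebesgue_on \<Omega>)"
        by (intro measurable_restrict_space1 measurable_completion) simp
      show "\<Omega> \<in> sets lebesgue" using meas by blast
      show "(\<lambda>x. \<bar>\<Phi> (H t)\<bar> + \<bar>\<Phi> (H (- t))\<bar>) integrable_on \<Omega>"
        using meas by (rule integrable_on_const)
      show "norm (g x) \<le> \<bar>\<Phi> (H t)\<bar> + \<bar>\<Phi> (H (- t))\<bar>" for x
        by (simp add: g_def)
    qed
    have f_int: "(\<lambda>x. \<Phi> (real_of_ereal (linear_distortion x f))) absolutely_integrable_on \<Omega>"
      using absolutely_integrable_spike[OF g_int N fg] .
    have "quasiconformal_on \<Omega> f"
      unfolding f_def using laminate_quasiconformal_on[OF m _ tK c] t by simp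
    moreover have "Linf_norm \<Omega> (\<lambda>z. f z - A *v z) < ereal \<epsilon>"
    proof -
      \<comment> \<open>Continuity supplies the measurability without which \<open>esssup\<close>
        takes the value top.\<close>
      have "continuous_on \<Omega> f"
        using \<open>quasiconformal_on \<Omega> f\<close> by (auto simp: quasiconformal_on_def homeomorphism_def)
      then have "(\<lambda>z. norm (f z - A *v z)) \<in> borel_measurable (lebesgue_on \<Omega>)"
        using meas by (intro continuous_imp_measurable_on_sets_lebesgue continuous_intros) auto
      moreover have "ereal (norm (f z - A *v z)) \<le> ereal (t * norm \<xi> / c)" for z
        using laminate_near_linear[of t c A \<xi> \<nu> z] t c by (simp add: f_def)
      ultimately have "Linf_norm \<Omega> (\<lambda>z. f z - A *v z) \<le> ereal (t * norm \<xi> / c)"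
        unfolding Linf_norm_def by (intro esssup_I) auto
      also have "t * norm \<xi> / c < \<epsilon>"
      proof -
        have "0 < 1 + t * norm \<xi>" using t by (simp add: add_pos_nonneg)
        then show ?thesis using \<epsilon> by (simp add: c_def field_simps)
      qed
      finally show ?thesis by simp
    qed
    moreover have "(LINT x:\<Omega>|lebesgue. \<Phi> (real_of_ereal (linear_distortion x f)))
        < (LINT x:\<Omega>|lebesgue. \<Phi> (matrix_distortion A)) - \<delta>"
    proof -
      have "(LINT x:\<Omega>|lebesgue. \<Phi> (real_of_ereal (linear_distortion x f)))
          = integral \<Omega> (\<lambda>x. \<Phi> (real_of_ereal (linear_distortion x f)))"
        by (rule set_lebesgue_integral_eq_integral(2)[OF f_int])
      also have "\<dots> = integral \<Omega> g"
        by (rule integral_spike[OF N]) (simp add: fg)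
      also have "\<dots> = (LINT x:\<Omega>|lebesgue. g x)"
        by (rule set_lebesgue_integral_eq_integral(2)[OF g_int, symmetric])
      also have "\<dots> \<le> (LINT x:\<Omega>|lebesgue. \<Phi> M)"
        using meas \<Phi>mono
        by (intro set_integral_mono[OF g_int] absolutely_integrable_on_const) (auto simp: g_def)
      also have "\<dots> = (LINT x:\<Omega>|lebesgue. \<Phi> (matrix_distortion A)) - 2 * \<delta>"
        unfolding set_integral_const[OF meas] \<delta>_def by (simp add: field_simps)
      finally show ?thesis using \<delta> by linarith
    qed
    ultimately show "\<exists>f :: real^3 \<Rightarrow> real^3.
           quasiconformal_on \<Omega> f \<and>
           Linf_norm \<Omega> (\<lambda>z. f z - A *v z) < ereal \<epsilon> \<and>
           set_integrable lebesgue \<Omega> (\<lambda>x. \<Phi> (real_of_ereal (linear_distortion x f))) \<and>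
           (LINT x:\<Omega>|lebesgue. \<Phi> (real_of_ereal (linear_distortion x f)))
             < (LINT x:\<Omega>|lebesgue. \<Phi> (matrix_distortion A)) - \<delta>"
      using f_int by blast
  qed
qed

end
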